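(* Let $\mathcal{A}$ be a unital associative algebra over a commutative unital ring $R$, let $d$ be a derivation of $\mathcal{A}$ and let $x,y\in\mathcal{A}$. The ternary derivation $(d+L_x+R_y,\ d+L_x,\ d+R_y)$ of $\mathcal{A}$ is an inner ternary derivation if and only if $d$ is an inner derivation of $\mathcal{A}$.
   Context: $L_a(z)=az$ and $R_a(z)=za$ are the left and right multiplication operators. A triple of $R$-linear maps $(d_1,d_2,d_3)$ of $\mathcal{A}$ is a ternary derivation if $d_1(uv)=d_2(u)v+ud_3(v)$ for all $u,v\in\mathcal{A}$. (Derivations are $R$-linear.) Every triple $(d+L_x+R_y,\ d+L_x,\ d+R_y)$ with $d$ a derivation is a ternary derivation, and every ternary derivation has this form. A derivation is inner if it equals $R_a-L_a$ for some $a\in\mathcal{A}$. A ternary derivation $(d_1,d_2,d_3)$ is an inner ternary derivation if there exist $a,b,c\in\mathcal{A}$ with $(d_1,d_2,d_3)=(L_a+R_b,\ L_a+R_c,\ -L_c+R_b)$. *)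

theory Defs
  imports "HOL-Algebra.Module"
begin

text \<open>
  The library locale \<open>algebra\<close> assumes a commutative multiplication, so associative algebras are
  introduced here. For a noncommutative product the compatibility of scalars with the right factor
  has to be assumed separately. The zero ring and the zero algebra are allowed.
\<close>

locale unital_assoc_algebra = module R A + ring A
  for R :: "('r, 'm) ring_scheme" (structure) and A :: "('r, 'a, 'n) module_scheme" (structure) +
  assumes smult_mult_left:
      "\<lbrakk>r \<in> carrier R; u \<in> carrier A; v \<in> carrier A\<rbrakk> \<Longrightarrow>
        (r \<odot>\<^bsub>A\<^esub> u) \<otimes>\<^bsub>A\<^esub> v = r \<odot>\<^bsub>A\<^esub> (u \<otimes>\<^bsub>A\<^esub> v)"
    and smult_mult_right:
      "\<lbrakk>r \<in> carrier R; u \<in> carrier A; v \<in> carrier A\<rbrakk> \<Longrightarrow>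
        u \<otimes>\<^bsub>A\<^esub> (r \<odot>\<^bsub>A\<^esub> v) = r \<odot>\<^bsub>A\<^esub> (u \<otimes>\<^bsub>A\<^esub> v)"

text \<open>
  Maps of the algebra are HOL functions of which only the values on the carrier matter. Accordingly,
  an equality of maps is expressed as equality at every element of the carrier.
\<close>

definition linear_endo :: "('r, 'm) ring_scheme \<Rightarrow> ('r, 'a, 'n) module_scheme \<Rightarrow> ('a \<Rightarrow> 'a) \<Rightarrow> bool"
  where "linear_endo R A f \<longleftrightarrow>
    f \<in> carrier A \<rightarrow> carrier A \<and>
    (\<forall>u\<in>carrier A. \<forall>v\<in>carrier A. f (u \<oplus>\<^bsub>A\<^esub> v) = f u \<oplus>\<^bsub>A\<^esub> f v) \<and>
    (\<forall>r\<in>carrier R. \<forall>u\<in>carrier A. f (r \<odot>\<^bsub>A\<^esub> u) = r \<odot>\<^bsub>A\<^esub> f u)"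

definition left_mult :: "('a, 'n) ring_scheme \<Rightarrow> 'a \<Rightarrow> 'a \<Rightarrow> 'a"
  where "left_mult A a = (\<lambda>z. a \<otimes>\<^bsub>A\<^esub> z)"

definition right_mult :: "('a, 'n) ring_scheme \<Rightarrow> 'a \<Rightarrow> 'a \<Rightarrow> 'a"
  where "right_mult A a = (\<lambda>z. z \<otimes>\<^bsub>A\<^esub> a)"

definition derivation :: "('r, 'm) ring_scheme \<Rightarrow> ('r, 'a, 'n) module_scheme \<Rightarrow> ('a \<Rightarrow> 'a) \<Rightarrow> bool"
  where "derivation R A d \<longleftrightarrow>
    linear_endo R A d \<and>
    (\<forall>u\<in>carrier A. \<forall>v\<in>carrier A. d (u \<otimes>\<^bsub>A\<^esub> v) = d u \<otimes>\<^bsub>A\<^esub> v \<oplus>\<^bsub>A\<^esub> u \<otimes>\<^bsub>A\<^esub> d v)"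

definition inner_derivation ::
    "('r, 'm) ring_scheme \<Rightarrow> ('r, 'a, 'n) module_scheme \<Rightarrow> ('a \<Rightarrow> 'a) \<Rightarrow> bool"
  where "inner_derivation R A d \<longleftrightarrow>
    derivation R A d \<and>
    (\<exists>a\<in>carrier A. \<forall>z\<in>carrier A. d z = right_mult A a z \<ominus>\<^bsub>A\<^esub> left_mult A a z)"

fun ternary_derivation ::
    "('r, 'm) ring_scheme \<Rightarrow> ('r, 'a, 'n) module_scheme \<Rightarrow>
     ('a \<Rightarrow> 'a) \<times> ('a \<Rightarrow> 'a) \<times> ('a \<Rightarrow> 'a) \<Rightarrow> bool"
  where "ternary_derivation R A (d\<^sub>1, d\<^sub>2, d\<^sub>3) \<longleftrightarrow>
    linear_endo R A d\<^sub>1 \<and> linear_endo R A d\<^sub>2 \<and> linear_endo R A d\<^sub>3 \<and>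
    (\<forall>u\<in>carrier A. \<forall>v\<in>carrier A. d\<^sub>1 (u \<otimes>\<^bsub>A\<^esub> v) = d\<^sub>2 u \<otimes>\<^bsub>A\<^esub> v \<oplus>\<^bsub>A\<^esub> u \<otimes>\<^bsub>A\<^esub> d\<^sub>3 v)"

fun inner_ternary_derivation ::
    "('r, 'm) ring_scheme \<Rightarrow> ('r, 'a, 'n) module_scheme \<Rightarrow>
     ('a \<Rightarrow> 'a) \<times> ('a \<Rightarrow> 'a) \<times> ('a \<Rightarrow> 'a) \<Rightarrow> bool"
  where "inner_ternary_derivation R A (d\<^sub>1, d\<^sub>2, d\<^sub>3) \<longleftrightarrow>
    ternary_derivation R A (d\<^sub>1, d\<^sub>2, d\<^sub>3) \<and>
    (\<exists>a\<in>carrier A. \<exists>b\<in>carrier A. \<exists>c\<in>carrier A. \<forall>z\<in>carrier A.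
      d\<^sub>1 z = left_mult A a z \<oplus>\<^bsub>A\<^esub> right_mult A b z \<and>
      d\<^sub>2 z = left_mult A a z \<oplus>\<^bsub>A\<^esub> right_mult A c z \<and>
      d\<^sub>3 z = \<ominus>\<^bsub>A\<^esub> left_mult A c z \<oplus>\<^bsub>A\<^esub> right_mult A b z)"

end

theory Submission
  imports Defs
begin

text \<open>
  Innerness of \<open>d\<close> can be read off from the second component. If \<open>d + L\<^sub>x = L\<^sub>a + R\<^sub>c\<close>, then
  evaluation at \<open>\<one>\<close>, where every derivation vanishes, gives \<open>x = a + c\<close>; substituting this back
  leaves \<open>d = R\<^sub>c - L\<^sub>c\<close> (\<open>commutator_if_left_shift_inner\<close>). Conversely, if \<open>d = R\<^sub>c - L\<^sub>c\<close>, keep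
  this \<open>c\<close>. Evaluation at \<open>\<one>\<close> of the second and third components leaves \<open>a = x - c\<close> and \<open>b = y + c\<close>
  as the only candidates, and with them all three equations hold (\<open>shift_of_commutator\<close>).

  An inner ternary derivation is in particular a ternary derivation, so the converse also uses that
  the triple is one (\<open>ternary_derivation_shift\<close>). This is the Leibniz rule for \<open>d\<close> together with
  associativity: \<open>x(uv) = (xu)v\<close> is charged to the second component, \<open>(uv)y = u(vy)\<close> to the third.
\<close>

lemma derivation_one:
  assumes "ring A" and "derivation R A d"
  shows "d \<one>\<^bsub>A\<^esub> = \<zero>\<^bsub>A\<^esub>"
proof -
  interpret ring A by fact
  have closed: "d \<one>\<^bsub>A\<^esub> \<in> carrier A"
    using assms(2) by (auto simp: derivation_def linear_endo_def)
  have "d (\<one>\<^bsub>A\<^esub> \<otimes>\<^bsub>A\<^esub> \<one>\<^bsub>A\<^esub>) = d \<one>\<^bsub>A\<^esub> \<otimes>\<^bsub>A\<^esub> \<one>\<^bsub>A\<^esub> \<oplus>\<^bsub>A\<^esub> \<one>\<^bsub>A\<^esub> \<otimes>\<^bsub>A\<^esub> d \<one>\<^bsub>A\<^esub>"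
    using assms(2) unfolding derivation_def by blast
  then have "d \<one>\<^bsub>A\<^esub> = d \<one>\<^bsub>A\<^esub> \<oplus>\<^bsub>A\<^esub> d \<one>\<^bsub>A\<^esub>"
    using closed by simp
  then show ?thesis
    using closed by (metis add.l_cancel_one')
qed

context unital_assoc_algebra
begin

lemma linear_endo_left_mult:
  assumes "a \<in> carrier A"
  shows "linear_endo R A (left_mult A a)"
proof -
  show ?thesis
    using assms by (auto simp: linear_endo_def left_mult_def r_distr smult_mult_right)
qed

lemma linear_endo_right_mult:
  assumes "a \<in> carrier A"
  shows "linear_endo R A (right_mult A a)"
proof -
  show ?thesis
    using assms by (auto simp: linear_endo_def right_mult_def l_distr smult_mult_left)
qed

lemma linear_endo_add:
  assumes "linear_endo R A f" and "linear_endo R A g"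
  shows "linear_endo R A (\<lambda>z. f z \<oplus>\<^bsub>A\<^esub> g z)"
proof -
  have closed: "f u \<in> carrier A" "g u \<in> carrier A" if "u \<in> carrier A" for u
    using assms that by (auto simp: linear_endo_def)
  show ?thesis
    using assms closed
    by (auto simp: linear_endo_def smult_r_distr M.a_ac)
qed

lemma ternary_derivation_shift:
  assumes d: "derivation R A d" and x: "x \<in> carrier A" and y: "y \<in> carrier A"
  shows "ternary_derivation R A
           ((\<lambda>z. d z \<oplus>\<^bsub>A\<^esub> left_mult A x z \<oplus>\<^bsub>A\<^esub> right_mult A y z),
            (\<lambda>z. d z \<oplus>\<^bsub>A\<^esub> left_mult A x z),
            (\<lambda>z. d z \<oplus>\<^bsub>A\<^esub> right_mult A y z))"
proof -
  have lin: "linear_endo R A d"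
    using d by (simp add: derivation_def)
  have closed: "d u \<in> carrier A" if "u \<in> carrier A" for u
    using lin that by (auto simp: linear_endo_def)
  have leibniz: "d (u \<otimes>\<^bsub>A\<^esub> v) = d u \<otimes>\<^bsub>A\<^esub> v \<oplus>\<^bsub>A\<^esub> u \<otimes>\<^bsub>A\<^esub> d v"
    if "u \<in> carrier A" "v \<in> carrier A" for u v
    using d that by (simp add: derivation_def)
  have "d (u \<otimes>\<^bsub>A\<^esub> v) \<oplus>\<^bsub>A\<^esub> x \<otimes>\<^bsub>A\<^esub> (u \<otimes>\<^bsub>A\<^esub> v) \<oplus>\<^bsub>A\<^esub> (u \<otimes>\<^bsub>A\<^esub> v) \<otimes>\<^bsub>A\<^esub> y
      = (d u \<oplus>\<^bsub>A\<^esub> x \<otimes>\<^bsub>A\<^esub> u) \<otimes>\<^bsub>A\<^esub> v \<oplus>\<^bsub>A\<^esub> u \<otimes>\<^bsub>A\<^esub> (d v \<oplus>\<^bsub>A\<^esub> v \<otimes>\<^bsub>A\<^esub> y)"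
    if "u \<in> carrier A" "v \<in> carrier A" for u v
    using that x y closed
    by (simp add: leibniz l_distr r_distr m_assoc M.a_ac)
  then show ?thesis
    using lin x y
    by (simp add: linear_endo_add linear_endo_left_mult linear_endo_right_mult)
      (simp add: left_mult_def right_mult_def)
qed

end

context ring
begin

text \<open>
  Taking \<open>z = \<one>\<close> in the hypothesis gives \<open>x = a \<oplus> c\<close>, and then \<open>a \<otimes> z\<close> cancels on both sides.
\<close>

lemma commutator_if_left_shift_inner:
  assumes closed: "f \<in> carrier R \<rightarrow> carrier R" and one: "f \<one> = \<zero>"
    and mem: "x \<in> carrier R" "a \<in> carrier R" "c \<in> carrier R"
    and eq: "\<And>z. z \<in> carrier R \<Longrightarrow> f z \<oplus> x \<otimes> z = a \<otimes> z \<oplus> z \<otimes> c"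
    and z: "z \<in> carrier R"
  shows "f z = z \<otimes> c \<ominus> c \<otimes> z"
proof -
  have fz: "f z \<in> carrier R"
    using closed z by blast
  have x: "x = a \<oplus> c"
    using eq[of \<one>] one mem by simp
  have "a \<otimes> z \<oplus> (f z \<oplus> c \<otimes> z) = a \<otimes> z \<oplus> z \<otimes> c"
    using eq[OF z] mem z fz by (simp add: x l_distr a_ac)
  then have "f z \<oplus> c \<otimes> z = z \<otimes> c"
    using mem z fz by simp
  then show ?thesis
    using mem z fz by (metis add.inv_solve_right m_closed minus_eq)
qed

lemma shift_of_commutator:
  assumes "x \<in> carrier R" "y \<in> carrier R" "c \<in> carrier R" "z \<in> carrier R"
  shows "(z \<otimes> c \<ominus> c \<otimes> z) \<oplus> x \<otimes> z = (x \<ominus> c) \<otimes> z \<oplus> z \<otimes> c"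
    and "(z \<otimes> c \<ominus> c \<otimes> z) \<oplus> z \<otimes> y = \<ominus> (c \<otimes> z) \<oplus> z \<otimes> (y \<oplus> c)"
    and "(z \<otimes> c \<ominus> c \<otimes> z) \<oplus> x \<otimes> z \<oplus> z \<otimes> y = (x \<ominus> c) \<otimes> z \<oplus> z \<otimes> (y \<oplus> c)"
  using assms by (simp_all add: minus_eq l_distr r_distr l_minus a_ac)

end

theorem theorem4p3:
  fixes R :: "('r, 'm) ring_scheme"
    and A :: "('r, 'a, 'n) module_scheme"
    and d :: "'a \<Rightarrow> 'a"
    and x y :: 'a
  assumes "unital_assoc_algebra R A"
    and "derivation R A d"
    and "x \<in> carrier A"
    and "y \<in> carrier A"
  shows "inner_ternary_derivation R A
           ((\<lambda>z. d z \<oplus>\<^bsub>A\<^esub> left_mult A x z \<oplus>\<^bsub>A\<^esub> right_mult A y z),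
            (\<lambda>z. d z \<oplus>\<^bsub>A\<^esub> left_mult A x z),
            (\<lambda>z. d z \<oplus>\<^bsub>A\<^esub> right_mult A y z))
         \<longleftrightarrow> inner_derivation R A d"
    (is "?ternary \<longleftrightarrow> ?inner")
proof
  interpret A: ring A
    using assms(1) by (simp add: unital_assoc_algebra_def)
  have closed: "d \<in> carrier A \<rightarrow> carrier A"
    using assms(2) by (simp add: derivation_def linear_endo_def)
  {
    assume ?ternary
    then obtain a c where mem: "a \<in> carrier A" "c \<in> carrier A"
      and second: "\<And>z. z \<in> carrier A \<Longrightarrow>
        d z \<oplus>\<^bsub>A\<^esub> x \<otimes>\<^bsub>A\<^esub> z = a \<otimes>\<^bsub>A\<^esub> z \<oplus>\<^bsub>A\<^esub> z \<otimes>\<^bsub>A\<^esub> c"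
      by (auto simp: left_mult_def right_mult_def)
    have "d z = z \<otimes>\<^bsub>A\<^esub> c \<ominus>\<^bsub>A\<^esub> c \<otimes>\<^bsub>A\<^esub> z" if "z \<in> carrier A" for z
      using A.commutator_if_left_shift_inner[OF closed
          derivation_one[OF A.ring_axioms assms(2)] assms(3) mem second that] .
    then show ?inner
      using assms(2) mem(2) by (auto simp: inner_derivation_def left_mult_def right_mult_def)
  next
    assume ?inner
    then obtain c where c: "c \<in> carrier A"
      and d: "\<And>z. z \<in> carrier A \<Longrightarrow> d z = z \<otimes>\<^bsub>A\<^esub> c \<ominus>\<^bsub>A\<^esub> c \<otimes>\<^bsub>A\<^esub> z"
      by (auto simp: inner_derivation_def left_mult_def right_mult_def)
    have "\<exists>a\<in>carrier A. \<exists>b\<in>carrier A. \<exists>c\<in>carrier A. \<forall>z\<in>carrier A.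
        d z \<oplus>\<^bsub>A\<^esub> left_mult A x z \<oplus>\<^bsub>A\<^esub> right_mult A y z
          = left_mult A a z \<oplus>\<^bsub>A\<^esub> right_mult A b z \<and>
        d z \<oplus>\<^bsub>A\<^esub> left_mult A x z = left_mult A a z \<oplus>\<^bsub>A\<^esub> right_mult A c z \<and>
        d z \<oplus>\<^bsub>A\<^esub> right_mult A y z = \<ominus>\<^bsub>A\<^esub> left_mult A c z \<oplus>\<^bsub>A\<^esub> right_mult A b z"
      by (rule bexI[of _ "x \<ominus>\<^bsub>A\<^esub> c"], rule bexI[of _ "y \<oplus>\<^bsub>A\<^esub> c"], rule bexI[of _ c])
        (use assms(3,4) c in \<open>auto simp: left_mult_def right_mult_def d intro: A.shift_of_commutator\<close>)
    then show ?ternary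
      using unital_assoc_algebra.ternary_derivation_shift[OF assms]
      unfolding inner_ternary_derivation.simps by blast
  }
qed

end
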